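(* Let $r,\kappa_1,\kappa_2,\kappa_3$ be positive integers, let $\pi_1,\dots,\pi_r$ be nonzero real numbers, and for $i\in\{1,2,3\}$ and $j\in\{1,\dots,r\}$ let $\mathbf{x}_{ij}\in\mathbb{R}^{\kappa_i}$. Write $\mathbf{X}_i=(\mathbf{x}_{i1},\dots,\mathbf{x}_{ir})\in\mathbb{R}^{\kappa_i\times r}$ and let $$\mathbb{X}=\sum_{j=1}^r\pi_j\,(\mathbf{x}_{1j}\otimes\mathbf{x}_{2j}\otimes\mathbf{x}_{3j}).$$ Let $\{i_1,i_2,i_3\}=\{1,2,3\}$ with $i_1<i_2$, and let $$\mathbb{X}_{\{i_1,i_2\}}=\sum_{j=1}^r\pi_j\,(\mathbf{x}_{i_1j}\otimes\mathbf{x}_{i_2j}).$$ If $\mathbf{X}_{i_1}$ and $\mathbf{X}_{i_2}$ both have full column rank (rank $r$) and $\mathbb{X}_{\{i_1,i_2\}}$ is observable (in addition to $\mathbb{X}$ and $r$), then $\mathbf{X}_{i_3}$ is identified up to a permutation matrix if all its columns are different. Explicitly: under these rank and distinctness conditions, if $\pi'_1,\dots,\pi'_r$ are nonzero reals and $\mathbf{x}'_{ij}\in\mathbb{R}^{\kappa_i}$ are vectors such that $\sum_{j}\pi'_j(\mathbf{x}'_{1j}\otimes\mathbf{x}'_{2j}\otimes\mathbf{x}'_{3j})=\mathbb{X}$ and $\sum_j\pi'_j(\mathbf{x}'_{i_1j}\otimes\mathbf{x}'_{i_2j})=\mathbb{X}_{\{i_1,i_2\}}$, then $\mathbf{X}'_{i_3}=\mathbf{X}_{i_3}\mathbf{P}$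 for some $r\times r$ permutation matrix $\mathbf{P}$, where $\mathbf{X}'_{i_3}=(\mathbf{x}'_{i_31},\dots,\mathbf{x}'_{i_3r})$.
   Context: $\otimes$ denotes the outer (tensor) product: $\mathbf{a}\otimes\mathbf{b}\otimes\mathbf{c}$ is the three-way array with entries $a_kb_lc_m$, and $\mathbf{a}\otimes\mathbf{b}$ is the matrix $\mathbf{a}\mathbf{b}^\prime$. The integer $r$ is known. A quantity is "observable" if its value is known in addition to $\mathbb{X}$. A parameter is "identified up to a permutation" if it is determined, up to a permutation of its columns, by the observable arrays and $r$; i.e. any $r$-term decomposition with nonzero weights generating the same observable arrays has the same value of that parameter up to a permutation of its columns. *)

theory Defs
  imports
    "Jordan_Normal_Form.Matrix"
    "Jordan_Normal_Form.DL_Rank"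
    "HOL-Combinatorics.Permutations"
begin

definition outer2 :: "real vec \<Rightarrow> real vec \<Rightarrow> real mat" where
  "outer2 a b = mat (dim_vec a) (dim_vec b) (\<lambda>(k, l). a $ k * b $ l)"

text \<open>A three-way array is a function on index triples that vanishes outside its index range
  \<open>{..<dim_vec a} \<times> {..<dim_vec b} \<times> {..<dim_vec c}\<close>, so that equality of two arrays of the same
  format is equality of all entries in range.\<close>

definition outer3 :: "real vec \<Rightarrow> real vec \<Rightarrow> real vec \<Rightarrow> nat \<times> nat \<times> nat \<Rightarrow> real" where
  "outer3 a b c = (\<lambda>(k, l, m).
     if k < dim_vec a \<and> l < dim_vec b \<and> m < dim_vec c then a $ k * b $ l * c $ m else 0)"

text \<open>In the following, \<open>x i j\<close> is the \<open>j\<close>-th vector of mode \<open>i\<close>, with modes \<open>i \<in> {1, 2, 3}\<close> and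
  \<open>j < r\<close> counted from 0; vectors of mode \<open>i\<close> have dimension \<open>\<kappa> i\<close>.\<close>

definition factor_mat :: "nat \<Rightarrow> (nat \<Rightarrow> nat) \<Rightarrow> (nat \<Rightarrow> nat \<Rightarrow> real vec) \<Rightarrow> nat \<Rightarrow> real mat" where
  "factor_mat r \<kappa> x i = mat_of_cols (\<kappa> i) (map (x i) [0..<r])"

definition three_way_array ::
  "nat \<Rightarrow> (nat \<Rightarrow> real) \<Rightarrow> (nat \<Rightarrow> nat \<Rightarrow> real vec) \<Rightarrow> nat \<times> nat \<times> nat \<Rightarrow> real" where
  "three_way_array r \<pi> x = (\<lambda>t. \<Sum>j<r. \<pi> j * outer3 (x 1 j) (x 2 j) (x 3 j) t)"

text \<open>The sum of matrices is written entrywise because the type of matrices (of arbitrary format)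
  is not a \<open>comm_monoid_add\<close>.\<close>

definition two_way_array ::
  "nat \<Rightarrow> (nat \<Rightarrow> nat) \<Rightarrow> (nat \<Rightarrow> real) \<Rightarrow> (nat \<Rightarrow> nat \<Rightarrow> real vec) \<Rightarrow> nat \<Rightarrow> nat \<Rightarrow> real mat" where
  "two_way_array r \<kappa> \<pi> x i i' =
     mat (\<kappa> i) (\<kappa> i') (\<lambda>kl. \<Sum>j<r. \<pi> j * outer2 (x i j) (x i' j) $$ kl)"

definition permutation_mat :: "nat \<Rightarrow> real mat \<Rightarrow> bool" where
  "permutation_mat n P \<longleftrightarrow>
     (\<exists>p. p permutes {..<n} \<and> P = mat n n (\<lambda>(i, j). if i = p j then 1 else 0))"

end

theory Submission
  imports Defs
begin

text \<open>Left inverses \<open>U\<close> of \<open>X i1\<close> and \<open>V\<close> of \<open>X i2\<close> turn the two-way array into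
  \<open>\<alpha> D' \<beta>\<^sup>T = D\<close> and the slice \<open>m\<close> (along mode \<open>i3\<close>) of the three-way array into
  \<open>\<alpha> D' C'\<^sub>m \<beta>\<^sup>T = D C\<^sub>m\<close>, where \<open>\<alpha> = U X' i1\<close>, \<open>\<beta> = V X' i2\<close> and \<open>D\<close>, \<open>D'\<close>, \<open>C\<^sub>m\<close>, \<open>C'\<^sub>m\<close>
  are diagonal matrices carrying the weights and the entries of the mode-\<open>i3\<close> vectors. The first
  equation makes \<open>\<beta>\<close> invertible, so \<open>\<alpha> C'\<^sub>m = C\<^sub>m \<alpha>\<close>: whenever \<open>\<alpha>\<close> has a nonzero entry at \<open>(s, j)\<close>,
  the \<open>j\<close>-th vector of \<open>X' i3\<close> is the \<open>s\<close>-th vector of \<open>X i3\<close>. Every row of \<open>\<alpha>\<close> has a nonzero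
  entry, and distinctness makes the resulting map from rows to columns injective.\<close>

section \<open>Left inverses of matrices of full column rank\<close>

text \<open>The rank is the size of a maximal independent subset of the set of columns, and a
  repeated column would make that set smaller than \<open>nc\<close>. Distinctness is what lets a
  nonzero kernel vector be read as a linear dependence of the column set.\<close>

lemma (in vec_space) full_rank_distinct_cols:
  assumes A: "A \<in> carrier_mat n nc" and rank: "rank A = nc"
  shows "distinct (cols A)"
proof -
  obtain S where S: "maximal S (\<lambda>T. T \<subseteq> set (cols A) \<and> lin_indpt T)"
    using maximal_exists[of "(\<lambda>T. T \<subseteq> set (cols A) \<and> lin_indpt T)" "card (set (cols A))" "{}"]
    by (meson List.finite_set card_mono empty_iff empty_subsetI finite_lin_indpt2 rev_finite_subset)
  then have "card S \<le> card (set (cols A))"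
    by (simp add: card_mono maximal_def)
  then have "length (cols A) \<le> card (set (cols A))"
    using rank_card_indpt[OF A S] rank A by simp
  then show ?thesis
    using card_distinct card_length le_antisym by blast
qed

lemma (in vec_space) full_rank_mult_vec_eq_0:
  assumes A: "A \<in> carrier_mat n nc" and rank: "rank A = nc"
    and v: "v \<in> carrier_vec nc" and Av: "A *\<^sub>v v = 0\<^sub>v n"
  shows "v = 0\<^sub>v nc"
  using full_rank_distinct_cols[OF A rank] full_rank_lin_indpt[OF A rank] lin_depI[OF A v _ Av]
  by blast

text \<open>The Gram matrix \<open>A\<^sup>T * A\<close> has trivial kernel: if it kills
  \<open>v\<close>, then the sum of squares of the entries of \<open>A *\<^sub>v v\<close> is 0, so
  \<open>A *\<^sub>v v\<close> vanishes and full rank gives \<open>v = 0\<close>. The left inverse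
  is the inverse of the Gram matrix times \<open>A\<^sup>T\<close>.\<close>

lemma full_rank_left_inverse:
  fixes A :: "real mat"
  assumes A: "A \<in> carrier_mat n nc" and rank: "vec_space.rank n A = nc"
  obtains U where "U \<in> carrier_mat nc n" "U * A = 1\<^sub>m nc"
proof -
  let ?G = "A\<^sup>T * A"
  have At: "A\<^sup>T \<in> carrier_mat nc n" and G: "?G \<in> carrier_mat nc nc"
    using A by auto
  have "v = 0\<^sub>v nc" if v: "v \<in> carrier_vec nc" and Gv: "?G *\<^sub>v v = 0\<^sub>v nc" for v
  proof -
    have Av: "A *\<^sub>v v \<in> carrier_vec n"
      using A v by auto
    have "(A *\<^sub>v v) \<bullet> (A *\<^sub>v v) = v \<bullet> (A\<^sup>T *\<^sub>v (A *\<^sub>v v))"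
      using transpose_vec_mult_scalar[OF A v Av] A v
      by (metis Av comm_scalar_prod At mult_mat_vec_carrier)
    also have "\<dots> = 0"
      unfolding assoc_mult_mat_vec[OF At A v, symmetric] Gv using v by simp
    finally have "(\<Sum>k = 0..<n. (A *\<^sub>v v) $ k * (A *\<^sub>v v) $ k) = 0"
      using A by (simp add: scalar_prod_def)
    then have "\<forall>k\<in>{0..<n}. (A *\<^sub>v v) $ k * (A *\<^sub>v v) $ k = 0"
      by (subst (asm) sum_nonneg_eq_0_iff) auto
    then have "A *\<^sub>v v = 0\<^sub>v n"
      using carrier_vecD[OF Av] by (intro eq_vecI) simp_all
    then show ?thesis
      by (rule vec_space.full_rank_mult_vec_eq_0[OF A rank v])
  qed
  then have det: "det ?G \<noteq> 0"
    using det_0_iff_vec_prod_zero_field[OF G] by blast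
  \<comment> \<open>The inverse of the Gram matrix, by the adjugate formula.\<close>
  let ?H = "(1 / det ?G) \<cdot>\<^sub>m adj_mat ?G"
  have H: "?H \<in> carrier_mat nc nc"
    using adj_mat(1)[OF G] by simp
  have "?H * ?G = (1 / det ?G) \<cdot>\<^sub>m (det ?G \<cdot>\<^sub>m 1\<^sub>m nc)"
    using mult_smult_assoc_mat[OF adj_mat(1)[OF G] G] adj_mat(3)[OF G] by metis
  also have "\<dots> = 1\<^sub>m nc"
    using det by (intro eq_matI) simp_all
  finally have "(?H * A\<^sup>T) * A = 1\<^sub>m nc"
    using assoc_mult_mat[OF H At A] by simp
  then show thesis
    using that[OF mult_carrier_mat[OF H At]] by blast
qed

text \<open>The rows of a left inverse form a family dual to the columns. Stated with sums, it can
  be applied directly to array entries.\<close>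

lemma full_rank_dual_family:
  assumes a: "\<And>j. j < r \<Longrightarrow> x i j \<in> carrier_vec (\<kappa> i)"
    and rank: "vec_space.rank (\<kappa> i) (factor_mat r \<kappa> x i) = r"
  obtains u :: "nat \<Rightarrow> nat \<Rightarrow> real"
  where "\<And>s j. s < r \<Longrightarrow> j < r \<Longrightarrow> (\<Sum>k<\<kappa> i. u s k * x i j $ k) = (if s = j then 1 else 0)"
proof -
  let ?A = "factor_mat r \<kappa> x i"
  have A: "?A \<in> carrier_mat (\<kappa> i) r"
    by (auto simp: factor_mat_def mat_of_cols_def)
  obtain U where U: "U \<in> carrier_mat r (\<kappa> i)" and UA: "U * ?A = 1\<^sub>m r"
    using full_rank_left_inverse[OF A rank] .
  show thesis
  proof
    fix s j assume sj: "s < r" "j < r"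
    have "(\<Sum>k<\<kappa> i. U $$ (s, k) * x i j $ k) = (U * ?A) $$ (s, j)"
      using U A sj
      by (auto simp: times_mat_def scalar_prod_def factor_mat_def mat_of_cols_def
          atLeast0LessThan intro!: sum.cong)
    then show "(\<Sum>k<\<kappa> i. U $$ (s, k) * x i j $ k) = (if s = j then 1 else 0)"
      using UA sj by simp
  qed
qed

section \<open>Contraction of arrays with dual families\<close>

lemma contract_bilinear_sum:
  fixes u v :: "nat \<Rightarrow> real"
  shows "(\<Sum>k<m. \<Sum>l<n. u k * v l * (\<Sum>j<r. w j * a j k * b j l)) =
    (\<Sum>j<r. w j * (\<Sum>k<m. u k * a j k) * (\<Sum>l<n. v l * b j l))"
proof -
  have "(\<Sum>k<m. \<Sum>l<n. u k * v l * (\<Sum>j<r. w j * a j k * b j l)) =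
      (\<Sum>k<m. \<Sum>l<n. \<Sum>j<r. w j * (u k * a j k) * (v l * b j l))"
    by (simp add: sum_distrib_left mult_ac)
  also have "\<dots> = (\<Sum>k<m. \<Sum>j<r. \<Sum>l<n. w j * (u k * a j k) * (v l * b j l))"
    by (intro sum.cong refl sum.swap)
  also have "\<dots> = (\<Sum>j<r. \<Sum>k<m. \<Sum>l<n. w j * (u k * a j k) * (v l * b j l))"
    by (rule sum.swap)
  also have "\<dots> = (\<Sum>j<r. w j * (\<Sum>k<m. u k * a j k) * (\<Sum>l<n. v l * b j l))"
    by (simp add: sum_distrib_left sum_distrib_right mult_ac)
  finally show ?thesis .
qed

text \<open>On the unprimed side duality kills every term except \<open>j = s = t\<close>. The
  weights \<open>w\<close> are left general so that both the two-way array and the slices of the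
  three-way array are covered.\<close>

lemma contract_dual_families:
  fixes u v :: "nat \<Rightarrow> nat \<Rightarrow> real"
  assumes eq: "\<And>k l. k < m \<Longrightarrow> l < n \<Longrightarrow>
      (\<Sum>j<r. w' j * a' j k * b' j l) = (\<Sum>j<r. w j * a j k * b j l)"
    and u: "\<And>s j. s < r \<Longrightarrow> j < r \<Longrightarrow> (\<Sum>k<m. u s k * a j k) = (if s = j then 1 else 0)"
    and v: "\<And>s j. s < r \<Longrightarrow> j < r \<Longrightarrow> (\<Sum>l<n. v s l * b j l) = (if s = j then 1 else 0)"
    and s: "s < r" and t: "t < r"
  shows "(\<Sum>j<r. w' j * (\<Sum>k<m. u s k * a' j k) * (\<Sum>l<n. v t l * b' j l)) =
    (if s = t then w s else 0)"
proof -
  have "(\<Sum>j<r. w' j * (\<Sum>k<m. u s k * a' j k) * (\<Sum>l<n. v t l * b' j l)) =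
      (\<Sum>j<r. w j * (\<Sum>k<m. u s k * a j k) * (\<Sum>l<n. v t l * b j l))"
    unfolding contract_bilinear_sum[symmetric] using eq by simp
  also have "\<dots> = (\<Sum>j<r. if j = s then (if s = t then w s else 0) else 0)"
    using u v s t by (intro sum.cong) auto
  also have "\<dots> = (if s = t then w s else 0)"
    using s by simp
  finally show ?thesis .
qed

text \<open>Dividing \<open>diag\<close> by \<open>d s\<close> exhibits a right inverse of the
  square matrix \<open>\<beta>\<close>, namely the transpose of \<open>\<alpha>\<close> with column
  \<open>s\<close> divided by \<open>d s\<close>. For square matrices it is also a left inverse, so
  the kernel of \<open>\<beta>\<close> is trivial.\<close>

lemma square_factor_injective:
  fixes \<alpha> \<beta> :: "nat \<Rightarrow> nat \<Rightarrow> real"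
  assumes diag: "\<And>s t. s < r \<Longrightarrow> t < r \<Longrightarrow>
      (\<Sum>j<r. \<alpha> s j * \<beta> t j) = (if s = t then d s else 0)"
    and d: "\<And>s. s < r \<Longrightarrow> d s \<noteq> 0"
    and w: "\<And>t. t < r \<Longrightarrow> (\<Sum>j<r. \<beta> t j * w j) = 0"
    and j: "j < r"
  shows "w j = 0"
proof -
  let ?A = "mat r r (\<lambda>(t, j). \<beta> t j)" and ?B = "mat r r (\<lambda>(j, s). \<alpha> s j / d s)"
  have A: "?A \<in> carrier_mat r r" and B: "?B \<in> carrier_mat r r"
    by auto
  have "?A * ?B = 1\<^sub>m r"
  proof (rule eq_matI)
    fix t s assume "t < dim_row (1\<^sub>m r :: real mat)" "s < dim_col (1\<^sub>m r :: real mat)"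
    then have ts: "t < r" "s < r"
      by auto
    have "(?A * ?B) $$ (t, s) = (\<Sum>j<r. \<alpha> s j * \<beta> t j) / d s"
      using ts by (simp add: scalar_prod_def sum_divide_distrib atLeast0LessThan mult_ac)
    then show "(?A * ?B) $$ (t, s) = (1\<^sub>m r :: real mat) $$ (t, s)"
      using diag[of s t] d[of s] ts by auto
  qed auto
  then have BA: "?B * ?A = 1\<^sub>m r"
    by (rule mat_mult_left_right_inverse[OF A B])
  have "?A *\<^sub>v vec r w = 0\<^sub>v r"
    using w by (intro eq_vecI) (auto simp: scalar_prod_def atLeast0LessThan)
  then have "(?B * ?A) *\<^sub>v vec r w = ?B *\<^sub>v 0\<^sub>v r"
    by (subst assoc_mult_mat_vec[OF B A]) auto
  also have "\<dots> = 0\<^sub>v r"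
    using B by (intro eq_vecI) (auto simp: scalar_prod_def)
  finally have "vec r w = 0\<^sub>v r"
    unfolding BA by simp
  then show ?thesis
    using j by (metis index_vec index_zero_vec(1))
qed

section \<open>Entries of the observable arrays\<close>

lemma two_way_array_entry:
  assumes "\<And>j. j < r \<Longrightarrow> x i j \<in> carrier_vec (\<kappa> i)"
    and "\<And>j. j < r \<Longrightarrow> x i' j \<in> carrier_vec (\<kappa> i')"
    and "k < \<kappa> i" "l < \<kappa> i'"
  shows "two_way_array r \<kappa> \<pi> x i i' $$ (k, l) = (\<Sum>j<r. \<pi> j * x i j $ k * x i' j $ l)"
proof -
  have "outer2 (x i j) (x i' j) $$ (k, l) = x i j $ k * x i' j $ l" if "j < r" for j
    using assms(1,2)[OF that] assms(3,4) by (simp add: outer2_def)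
  then show ?thesis
    using assms(3,4) by (simp add: two_way_array_def mult.assoc)
qed

text \<open>Giving the index triple as a function of the mode treats all assignments of
  \<open>i1\<close>, \<open>i2\<close>, \<open>i3\<close> at once: the product of the three entries
  does not depend on the order of the modes. The \<open>i3\<close> entry is grouped with the weight,
  as a slice requires.\<close>

lemma three_way_array_entry:
  assumes "\<And>i j. i \<in> {1, 2, 3} \<Longrightarrow> j < r \<Longrightarrow> x i j \<in> carrier_vec (\<kappa> i)"
    and "\<And>i. i \<in> {1, 2, 3} \<Longrightarrow> k i < \<kappa> i"
    and "{i1, i2, i3} = {1, 2, 3}"
  shows "three_way_array r \<pi> x (k 1, k 2, k 3) =
    (\<Sum>j<r. (\<pi> j * x i3 j $ k i3) * x i1 j $ k i1 * x i2 j $ k i2)"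
proof -
  \<comment> \<open>A list of length 3 whose set has three elements has no repetition.\<close>
  have "distinct [i1, i2, i3]"
  proof (rule card_distinct)
    show "card (set [i1, i2, i3]) = length [i1, i2, i3]"
      using assms(3) by simp
  qed
  moreover have "i1 \<in> {1, 2, 3}" "i2 \<in> {1, 2, 3}" "i3 \<in> {1, 2, 3}"
    using assms(3) by blast+
  ultimately have prod: "x 1 j $ k 1 * x 2 j $ k 2 * x 3 j $ k 3 =
      x i3 j $ k i3 * x i1 j $ k i1 * x i2 j $ k i2" for j
    by auto
  have dims: "k 1 < dim_vec (x 1 j) \<and> k 2 < dim_vec (x 2 j) \<and> k 3 < dim_vec (x 3 j)"
    if "j < r" for j
    using assms(1)[of 1 j] assms(1)[of 2 j] assms(1)[of 3 j]
      assms(2)[of 1] assms(2)[of 2] assms(2)[of 3] that by simp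
  show ?thesis
    unfolding three_way_array_def outer3_def
    using dims prod by (intro sum.cong refl) (simp add: mult.assoc)
qed

text \<open>Choosing a matching column for each \<open>s\<close> gives a map of
  \<open>{..<r}\<close> into itself. It is injective because two indices with the same match would
  have equal columns in \<open>x\<close>, hence bijective by finiteness.\<close>

lemma matched_columns_permutation:
  fixes x x' :: "nat \<Rightarrow> nat \<Rightarrow> real vec"
  assumes inj: "\<And>j j'. j < r \<Longrightarrow> j' < r \<Longrightarrow> j \<noteq> j' \<Longrightarrow> x i j \<noteq> x i j'"
    and match: "\<And>s. s < r \<Longrightarrow> \<exists>j<r. x' i j = x i s"
  obtains P where "permutation_mat r P" "factor_mat r \<kappa> x' i = factor_mat r \<kappa> x i * P"
proof -
  obtain f where f: "\<And>s. s < r \<Longrightarrow> f s < r \<and> x' i (f s) = x i s"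
    using match by metis
  have "inj_on f {..<r}"
    by (rule inj_onI) (metis f inj lessThan_iff)
  moreover have "f ` {..<r} \<subseteq> {..<r}"
    using f by auto
  ultimately have bij: "bij_betw f {..<r} {..<r}"
    using endo_inj_surj[of "{..<r}" f] by (simp add: bij_betw_def)
  \<comment> \<open>The inverse of \<open>f\<close>, extended by the identity because
    \<open>permutes\<close> demands fixed points outside the set.\<close>
  define q where "q j = (if j < r then inv_into {..<r} f j else j)" for j
  have "bij_betw q {..<r} {..<r}"
    using bij_betw_inv_into[OF bij] bij_betw_cong[of "{..<r}" q "inv_into {..<r} f"]
    by (simp add: q_def)
  then have q: "q permutes {..<r}"
    by (rule bij_imp_permutes) (simp add: q_def)
  have x': "x' i j = x i (q j)" and qr: "q j < r" if j: "j < r" for j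
  proof -
    show "q j < r"
      using permutes_in_image[OF q, of j] j by simp
    moreover have "f (q j) = j"
      using bij_betw_inv_into_right[OF bij, of j] j by (simp add: q_def)
    ultimately show "x' i j = x i (q j)"
      using f by metis
  qed
  \<comment> \<open>Column \<open>j\<close> is the unit vector at \<open>q j\<close>, so multiplying
    by it from the right selects column \<open>q j\<close>.\<close>
  let ?P = "mat r r (\<lambda>(i, j). if i = q j then 1 else 0) :: real mat"
  have "factor_mat r \<kappa> x' i = factor_mat r \<kappa> x i * ?P"
  proof (rule eq_matI)
    fix k j assume "k < dim_row (factor_mat r \<kappa> x i * ?P)" "j < dim_col (factor_mat r \<kappa> x i * ?P)"
    then have kj: "k < \<kappa> i" "j < r"
      by (auto simp: factor_mat_def)
    have "(factor_mat r \<kappa> x i * ?P) $$ (k, j) = (\<Sum>l<r. x i l $ k * (if l = q j then 1 else 0))"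
      using kj by (auto simp: factor_mat_def scalar_prod_def mat_of_cols_def atLeast0LessThan
          intro!: sum.cong)
    also have "\<dots> = x i (q j) $ k"
      using qr[OF kj(2)] by (simp add: if_distrib cong: if_cong)
    finally show "factor_mat r \<kappa> x' i $$ (k, j) = (factor_mat r \<kappa> x i * ?P) $$ (k, j)"
      using kj x' by (simp add: factor_mat_def mat_of_cols_def)
  qed (auto simp: factor_mat_def)
  moreover have "permutation_mat r ?P"
    using q by (auto simp: permutation_mat_def)
  ultimately show thesis
    using that by blast
qed

section \<open>Identification of the mode-\<open>i3\<close> vectors\<close>

theorem theorem1:
  fixes r :: nat and \<kappa> :: "nat \<Rightarrow> nat"
    and \<pi> :: "nat \<Rightarrow> real" and x :: "nat \<Rightarrow> nat \<Rightarrow> real vec"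
    and i1 i2 i3 :: nat
  assumes "r > 0"
    and "\<And>i. i \<in> {1, 2, 3} \<Longrightarrow> \<kappa> i > 0"
    and "\<And>j. j < r \<Longrightarrow> \<pi> j \<noteq> 0"
    and "\<And>i j. i \<in> {1, 2, 3} \<Longrightarrow> j < r \<Longrightarrow> x i j \<in> carrier_vec (\<kappa> i)"
    and "{i1, i2, i3} = {1, 2, 3}" and "i1 < i2"
    and "vec_space.rank (\<kappa> i1) (factor_mat r \<kappa> x i1) = r"
    and "vec_space.rank (\<kappa> i2) (factor_mat r \<kappa> x i2) = r"
    and "\<And>j j'. j < r \<Longrightarrow> j' < r \<Longrightarrow> j \<noteq> j' \<Longrightarrow> x i3 j \<noteq> x i3 j'"
  shows "\<forall>(\<pi>' :: nat \<Rightarrow> real) (x' :: nat \<Rightarrow> nat \<Rightarrow> real vec).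
      (\<forall>j<r. \<pi>' j \<noteq> 0) \<longrightarrow>
      (\<forall>i\<in>{1, 2, 3}. \<forall>j<r. x' i j \<in> carrier_vec (\<kappa> i)) \<longrightarrow>
      three_way_array r \<pi>' x' = three_way_array r \<pi> x \<longrightarrow>
      two_way_array r \<kappa> \<pi>' x' i1 i2 = two_way_array r \<kappa> \<pi> x i1 i2 \<longrightarrow>
      (\<exists>P. permutation_mat r P \<and> factor_mat r \<kappa> x' i3 = factor_mat r \<kappa> x i3 * P)"
proof (intro allI impI)
  fix \<pi>' :: "nat \<Rightarrow> real" and x' :: "nat \<Rightarrow> nat \<Rightarrow> real vec"
  assume "\<forall>j<r. \<pi>' j \<noteq> 0"
    and "\<forall>i\<in>{1, 2, 3}. \<forall>j<r. x' i j \<in> carrier_vec (\<kappa> i)"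
    and three: "three_way_array r \<pi>' x' = three_way_array r \<pi> x"
    and two: "two_way_array r \<kappa> \<pi>' x' i1 i2 = two_way_array r \<kappa> \<pi> x i1 i2"
  then have \<pi>': "\<And>j. j < r \<Longrightarrow> \<pi>' j \<noteq> 0"
    and x': "\<And>i j. i \<in> {1, 2, 3} \<Longrightarrow> j < r \<Longrightarrow> x' i j \<in> carrier_vec (\<kappa> i)"
    by blast+
  note x = assms(4)
  have i: "i1 \<in> {1, 2, 3}" "i2 \<in> {1, 2, 3}" "i3 \<in> {1, 2, 3}"
    using assms(5) by blast+
  have "distinct [i1, i2, i3]"
  proof (rule card_distinct)
    show "card (set [i1, i2, i3]) = length [i1, i2, i3]"
      using assms(5) by simp
  qed
  then have ne: "i1 \<noteq> i2" "i1 \<noteq> i3" "i2 \<noteq> i3"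
    by auto
  obtain u where u: "\<And>s j. s < r \<Longrightarrow> j < r \<Longrightarrow>
      (\<Sum>k<\<kappa> i1. u s k * x i1 j $ k) = (if s = j then 1 else 0)"
    using full_rank_dual_family[of r x i1 \<kappa>, OF x[OF i(1)] assms(7)] by blast
  obtain v where v: "\<And>s j. s < r \<Longrightarrow> j < r \<Longrightarrow>
      (\<Sum>k<\<kappa> i2. v s k * x i2 j $ k) = (if s = j then 1 else 0)"
    using full_rank_dual_family[of r x i2 \<kappa>, OF x[OF i(2)] assms(8)] by blast
  define \<alpha> where "\<alpha> s j = (\<Sum>k<\<kappa> i1. u s k * x' i1 j $ k)" for s j
  define \<beta> where "\<beta> t j = (\<Sum>l<\<kappa> i2. v t l * x' i2 j $ l)" for t j
  have two_entry: "(\<Sum>j<r. \<pi>' j * x' i1 j $ k * x' i2 j $ l) = (\<Sum>j<r. \<pi> j * x i1 j $ k * x i2 j $ l)"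
    if "k < \<kappa> i1" "l < \<kappa> i2" for k l
    using two_way_array_entry[of r x' i1 \<kappa> i2 k l \<pi>'] two_way_array_entry[of r x i1 \<kappa> i2 k l \<pi>]
      x x' i two that by simp
  have three_entry: "(\<Sum>j<r. (\<pi>' j * x' i3 j $ m) * x' i1 j $ k * x' i2 j $ l) =
      (\<Sum>j<r. (\<pi> j * x i3 j $ m) * x i1 j $ k * x i2 j $ l)"
    if "k < \<kappa> i1" "l < \<kappa> i2" "m < \<kappa> i3" for k l m
  proof -
    \<comment> \<open>Puts \<open>k\<close>, \<open>l\<close>, \<open>m\<close> at the modes
      \<open>i1\<close>, \<open>i2\<close>, \<open>i3\<close>; the last branch serves
      \<open>i3\<close>.\<close>
    define idx where "idx i = (if i = i1 then k else if i = i2 then l else m)" for i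
    have idx: "idx i < \<kappa> i" if "i \<in> {1, 2, 3}" for i
    proof -
      have "i \<in> {i1, i2, i3}"
        using that assms(5) by simp
      then show ?thesis
        using \<open>k < \<kappa> i1\<close> \<open>l < \<kappa> i2\<close> \<open>m < \<kappa> i3\<close> by (auto simp: idx_def)
    qed
    have idx_eq: "idx i1 = k" "idx i2 = l" "idx i3 = m"
      using ne by (auto simp: idx_def)
    have "three_way_array r \<pi>' x' (idx 1, idx 2, idx 3) =
        (\<Sum>j<r. (\<pi>' j * x' i3 j $ m) * x' i1 j $ k * x' i2 j $ l)"
      using three_way_array_entry[of r x' \<kappa> idx, OF x' idx assms(5)] unfolding idx_eq .
    moreover have "three_way_array r \<pi> x (idx 1, idx 2, idx 3) =
        (\<Sum>j<r. (\<pi> j * x i3 j $ m) * x i1 j $ k * x i2 j $ l)"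
      using three_way_array_entry[of r x \<kappa> idx, OF x idx assms(5)] unfolding idx_eq .
    ultimately show ?thesis
      using three by (simp only:)
  qed
  have diag: "(\<Sum>j<r. \<pi>' j * \<alpha> s j * \<beta> t j) = (if s = t then \<pi> s else 0)"
    if "s < r" "t < r" for s t
    unfolding \<alpha>_def \<beta>_def using contract_dual_families[OF two_entry u v that] .
  \<comment> \<open>A slice is a two-way array whose weights have absorbed the \<open>m\<close>-th
    entries of the mode-\<open>i3\<close> vectors.\<close>
  have slice: "(\<Sum>j<r. \<pi>' j * x' i3 j $ m * \<alpha> s j * \<beta> t j) = (if s = t then \<pi> s * x i3 s $ m else 0)"
    if "s < r" "t < r" "m < \<kappa> i3" for s t m
    unfolding \<alpha>_def \<beta>_def
    using contract_dual_families[OF three_entry[OF _ _ that(3)] u v that(1,2)] .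
  have "\<exists>j<r. x' i3 j = x i3 s" if s: "s < r" for s
  proof -
    \<comment> \<open>The sum is the diagonal value \<open>\<pi> s\<close>, so some summand, and
      with it some \<open>\<alpha> s j\<close>, is nonzero.\<close>
    have "(\<Sum>j<r. \<pi>' j * \<alpha> s j * \<beta> s j) \<noteq> 0"
      using diag[OF s s] assms(3)[OF s] by simp
    then obtain j where j: "j < r" and \<alpha>: "\<alpha> s j \<noteq> 0"
      by (auto elim: sum.not_neutral_contains_not_neutral)
    have "x' i3 j = x i3 s"
    proof (rule eq_vecI)
      fix m assume "m < dim_vec (x i3 s)"
      then have m: "m < \<kappa> i3"
        using x[OF i(3) s] by simp
      \<comment> \<open>Subtract \<open>x i3 s $ m\<close> times \<open>diag\<close> from
        \<open>slice\<close>: both right-hand sides vanish for \<open>s \<noteq> t\<close> and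
        cancel for \<open>s = t\<close>. The bracketed vector, indexed by \<open>j\<close>, thus
        lies in the kernel of \<open>\<beta>\<close>.\<close>
      have sum_eq: "(\<Sum>j<r. \<beta> t j * (\<pi>' j * \<alpha> s j * (x' i3 j $ m - x i3 s $ m))) = 0" if t: "t < r" for t
      proof -
        have "(\<Sum>j<r. \<beta> t j * (\<pi>' j * \<alpha> s j * (x' i3 j $ m - x i3 s $ m))) =
            (\<Sum>j<r. \<pi>' j * x' i3 j $ m * \<alpha> s j * \<beta> t j) - x i3 s $ m * (\<Sum>j<r. \<pi>' j * \<alpha> s j * \<beta> t j)"
          by (simp add: sum_distrib_left sum_subtractf algebra_simps)
        then show ?thesis
          using diag[OF s t] slice[OF s t m] by simp
      qed
      \<comment> \<open>The weights \<open>\<pi>'\<close> are moved into the first factor, so that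
        \<open>diag\<close> has the form needed for the injectivity of \<open>\<beta>\<close>, with
        \<open>d = \<pi>\<close>.\<close>
      have "\<pi>' j * \<alpha> s j * (x' i3 j $ m - x i3 s $ m) = 0"
        by (rule square_factor_injective[of r "\<lambda>s j. \<pi>' j * \<alpha> s j" \<beta> \<pi>
            "\<lambda>j. \<pi>' j * \<alpha> s j * (x' i3 j $ m - x i3 s $ m)" j, OF diag assms(3) sum_eq j])
      then show "x' i3 j $ m = x i3 s $ m"
        using \<alpha> \<pi>'[OF j] by simp
    qed (use x[OF i(3) s] x'[OF i(3) j] in simp)
    then show ?thesis
      using j by blast
  qed
  then obtain P where "permutation_mat r P" "factor_mat r \<kappa> x' i3 = factor_mat r \<kappa> x i3 * P"
    using matched_columns_permutation[of r x i3 x' \<kappa>] assms(9) by blast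
  then show "\<exists>P. permutation_mat r P \<and> factor_mat r \<kappa> x' i3 = factor_mat r \<kappa> x i3 * P"
    by blast
qed

end
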